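(* Let $k$ be a positive integer and $\Gamma$ a connected loopless $2k$-regular graph (parallel edges allowed). Let $v,w$ be distinct vertices of $\Gamma$. Let $M$ be a $k$DSI matrix of $\Gamma-v$ with special vertex $w$, and let $N$ be a $k$DSI matrix of $\Gamma-w$ with special vertex $v$. Then $\mathrm{Perm}(M)=\pm\mathrm{Perm}(N)$. If moreover $k$ is even and both $M$ and $N$ are constructed using the orientation of the edges induced by an Eulerian circuit of $\Gamma$ (each edge oriented in the direction it is traversed), then $\mathrm{Perm}(M)=\mathrm{Perm}(N)$.
   Context: Given a graph $G$ with an orientation of its edges, its signed incidence matrix $M^*$ has rows indexed by vertices and columns by edges, with entry $1$ if the vertex is the tail of the edge, $-1$ if it is the head, and $0$ otherwise. For a chosen vertex $u$ (the special vertex), let $M_0$ be $M^*$ with the row of $u$ deleted. The $k$DSI matrix of $G$ with special vertex $u$ is the block matrix obtained by stacking $k$ copies of $M_0$ vertically. For a $2k$-regular $\Gamma$ and any vertex $v$, $\Gamma-v$ satisfies $|E|=k(|V|-1)$, so these matrices are square. The permanent of an $n\times n$ matrix $A$ is $\mathrm{Perm}(A)=\sum_{\sigma\in S_n}\prod_i a_{i,\sigma(i)}$. *)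

theory Defs
  imports "HOL-Combinatorics.Permutations" "Jordan_Normal_Form.Matrix"
begin

text \<open>
  Undirected multigraphs: the edges are abstract names, so that distinct edges may have the same
  ends. A loop is an edge whose set of ends is a singleton.
\<close>

record ('v, 'e) multigraph =
  verts :: "'v set"
  edges :: "'e set"
  ends :: "'e \<Rightarrow> 'v set"

definition finite_multigraph :: "('v, 'e) multigraph \<Rightarrow> bool" where
  "finite_multigraph G \<longleftrightarrow>
     finite (verts G) \<and> finite (edges G) \<and>
     (\<forall>e \<in> edges G. \<exists>x \<in> verts G. \<exists>y \<in> verts G. ends G e = {x, y})"

definition loopless :: "('v, 'e) multigraph \<Rightarrow> bool" where
  "loopless G \<longleftrightarrow> (\<forall>e \<in> edges G. \<forall>x. ends G e \<noteq> {x})"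

text \<open>The second summand makes a loop contribute two to the degree.\<close>

definition degree :: "('v, 'e) multigraph \<Rightarrow> 'v \<Rightarrow> nat" where
  "degree G x = card {e \<in> edges G. x \<in> ends G e} + card {e \<in> edges G. ends G e = {x}}"

definition regular :: "nat \<Rightarrow> ('v, 'e) multigraph \<Rightarrow> bool" where
  "regular d G \<longleftrightarrow> (\<forall>x \<in> verts G. degree G x = d)"

definition adjacency :: "('v, 'e) multigraph \<Rightarrow> ('v \<times> 'v) set" where
  "adjacency G = {(x, y). \<exists>e \<in> edges G. ends G e = {x, y}}"

definition connected_multigraph :: "('v, 'e) multigraph \<Rightarrow> bool" where
  "connected_multigraph G \<longleftrightarrow>
     verts G \<noteq> {} \<and> (\<forall>x \<in> verts G. \<forall>y \<in> verts G. (x, y) \<in> (adjacency G)\<^sup>*)"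

definition delete_vertex :: "('v, 'e) multigraph \<Rightarrow> 'v \<Rightarrow> ('v, 'e) multigraph" where
  "delete_vertex G x =
     \<lparr>verts = verts G - {x}, edges = {e \<in> edges G. x \<notin> ends G e}, ends = ends G\<rparr>"

text \<open>
  An orientation maps an edge to the pair (tail, head). It is constrained only on the edges
  of the graph, so an orientation of a graph also serves as one of its vertex-deleted subgraphs.
\<close>

definition orientation :: "('v, 'e) multigraph \<Rightarrow> ('e \<Rightarrow> 'v \<times> 'v) \<Rightarrow> bool" where
  "orientation G d \<longleftrightarrow> (\<forall>e \<in> edges G. ends G e = {fst (d e), snd (d e)})"

text \<open>
  The circuit traverses the edge \<open>es ! i\<close> from \<open>xs ! i\<close> to \<open>xs ! Suc i\<close>.
\<close>

definition eulerian_circuit :: "('v, 'e) multigraph \<Rightarrow> 'v list \<Rightarrow> 'e list \<Rightarrow> bool" where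
  "eulerian_circuit G xs es \<longleftrightarrow>
     length xs = Suc (length es) \<and> set xs \<subseteq> verts G \<and> hd xs = last xs \<and>
     (\<forall>i < length es. ends G (es ! i) = {xs ! i, xs ! Suc i}) \<and>
     distinct es \<and> set es = edges G"

definition circuit_orientation :: "'v list \<Rightarrow> 'e list \<Rightarrow> ('e \<Rightarrow> 'v \<times> 'v) \<Rightarrow> bool" where
  "circuit_orientation xs es d \<longleftrightarrow> (\<forall>i < length es. d (es ! i) = (xs ! i, xs ! Suc i))"

text \<open>The lists of vertices and edges fix the order of the rows and columns.\<close>

definition signed_incidence_mat :: "('e \<Rightarrow> 'v \<times> 'v) \<Rightarrow> 'v list \<Rightarrow> 'e list \<Rightarrow> int mat" where
  "signed_incidence_mat d xs es =
     mat (length xs) (length es)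
       (\<lambda>(i, j). if xs ! i = fst (d (es ! j)) then 1
                 else if xs ! i = snd (d (es ! j)) then - 1 else 0)"

definition stack_copies :: "nat \<Rightarrow> 'a mat \<Rightarrow> 'a mat" where
  "stack_copies k A =
     mat (k * dim_row A) (dim_col A) (\<lambda>(i, j). A $$ (i mod dim_row A, j))"

text \<open>
  \<open>kDSI_matrix_wrt k G d u M\<close>: \<open>M\<close> is a \<open>k\<close>DSI matrix of \<open>G\<close> with special vertex \<open>u\<close>, built
  with the orientation \<open>d\<close>. The orders of the vertices and edges are arbitrary.
  Removing \<open>u\<close> from the list of row labels deletes the row of \<open>u\<close>.
\<close>

definition kDSI_matrix_wrt ::
  "nat \<Rightarrow> ('v, 'e) multigraph \<Rightarrow> ('e \<Rightarrow> 'v \<times> 'v) \<Rightarrow> 'v \<Rightarrow> int mat \<Rightarrow> bool" where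
  "kDSI_matrix_wrt k G d u M \<longleftrightarrow>
     orientation G d \<and> u \<in> verts G \<and>
     (\<exists>xs es. distinct xs \<and> set xs = verts G \<and> distinct es \<and> set es = edges G \<and>
        M = stack_copies k (signed_incidence_mat d (remove1 u xs) es))"

definition kDSI_matrix :: "nat \<Rightarrow> ('v, 'e) multigraph \<Rightarrow> 'v \<Rightarrow> int mat \<Rightarrow> bool" where
  "kDSI_matrix k G u M \<longleftrightarrow> (\<exists>d. kDSI_matrix_wrt k G d u M)"

text \<open>As for the library's determinant, the value at a non-square matrix is zero.\<close>

definition permanent :: "'a :: comm_semiring_1 mat \<Rightarrow> 'a" where
  "permanent A =
     (if dim_row A = dim_col A
      then \<Sum>p | p permutes {0..<dim_row A}. \<Prod>i = 0..<dim_row A. A $$ (i, p i)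
      else 0)"

end

(*
Sort the permutations in the permanent of a kDSI matrix of G - v with special vertex w by the
vertex from which each edge (column) takes its entry. Up to a factor common to all terms, the
permanent is the sum, over the assignments f of an end f e to each edge e of G - v such that every
vertex other than v and w is used exactly k times, of the product of the incidence signs of e at
f e. In a 2k-regular graph such an f turns into an assignment for G - w: an edge between v and x
is assigned x, and every edge that avoids v and w switches to its other end. Each vertex
x other than v and w has degree 2k and was used k times, so it is again used k times.
The signs of corresponding terms differ by a factor that does not depend on f, because the
edges at v or w have forced assignments and each remaining edge swaps its ends.
For the orientation of an Eulerian circuit the number of minus signs is congruent to |E| modulo 2,
and |E| = k (|V| - 2) + 2k is even for even k.
*)
theory Submission imports Defs
begin

section \<open>Permanents of stacked matrices as sums over assignments\<close>

text \<open>
  Row \<open>i\<close> of \<open>k\<close> stacked copies of a matrix with \<open>n\<close> rows is row \<open>i mod n\<close> of that matrix, so these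
  are the row permutations that fix the stacked matrix whatever its entries.
\<close>

definition residue_preserving_perms :: "nat \<Rightarrow> nat \<Rightarrow> (nat \<Rightarrow> nat) set" where
  "residue_preserving_perms k n =
     {r. r permutes {0..<k * n} \<and> (\<forall>i<k * n. r i mod n = i mod n)}"

text \<open>Extensional functions are used so that an assignment is determined by its values on
  \<open>E\<close>; otherwise the set would be infinite and a sum over it meaningless.\<close>

definition assignments :: "nat \<Rightarrow> 'e set \<Rightarrow> 'v set \<Rightarrow> ('e \<Rightarrow> 'v) set" where
  "assignments k E X = {f \<in> E \<rightarrow>\<^sub>E X. \<forall>x\<in>X. card {e \<in> E. f e = x} = k}"

lemma finite_assignments: "finite E \<Longrightarrow> finite X \<Longrightarrow> finite (assignments k E X)"
  unfolding assignments_def by (simp add: finite_PiE)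

lemma card_filter_bij_betw:
  assumes "bij_betw h A B"
  shows "card {b \<in> B. P b} = card {a \<in> A. P (h a)}"
proof -
  have "{b \<in> B. P b} = h ` {a \<in> A. P (h a)}"
    using assms by (auto simp: bij_betw_def)
  moreover have "inj_on h {a \<in> A. P (h a)}"
    using assms by (auto simp: bij_betw_def intro: inj_on_subset)
  ultimately show ?thesis by (simp add: card_image)
qed

lemma card_residue_class:
  assumes "a < n"
  shows "card {i \<in> {0..<k * n}. i mod n = a} = (k :: nat)"
proof -
  have "{i \<in> {0..<k * n}. i mod n = a} = (\<lambda>c. c * n + a) ` {0..<k}"
  proof (rule subset_antisym; rule subsetI)
    fix i assume "i \<in> {i \<in> {0..<k * n}. i mod n = a}"
    then have "i = (i div n) * n + a" "i div n < k"
      by (auto simp: less_mult_imp_div_less)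
    then show "i \<in> (\<lambda>c. c * n + a) ` {0..<k}" by auto
  next
    fix i assume "i \<in> (\<lambda>c. c * n + a) ` {0..<k}"
    then obtain c where c: "c < k" "i = c * n + a" by auto
    have "c * n + a < Suc c * n" using assms by simp
    also have "\<dots> \<le> k * n" using c(1) by (intro mult_le_mono1) simp
    finally show "i \<in> {i \<in> {0..<k * n}. i mod n = a}" using c assms by simp
  qed
  moreover have "inj_on (\<lambda>c. c * n + a) {0..<k}" using assms by (auto simp: inj_on_def)
  ultimately show ?thesis by (simp add: card_image)
qed

text \<open>A permutation matches every column with a copy of some vertex row, and its term depends
  only on which vertex each column receives. The permutations with the same underlying assignment
  form a coset of the group of permutations that shuffle copies of the same row, so every assignment
  is counted equally often.\<close>

lemma permanent_eq_sum_assignments: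
  fixes s :: "'e \<Rightarrow> 'v \<Rightarrow> 'a :: comm_semiring_1"
  assumes "distinct xs" "distinct es" and len: "length es = k * length xs"
  shows "permanent (stack_copies k (mat (length xs) (length es) (\<lambda>(i, j). s (es ! j) (xs ! i)))) =
    of_nat (card (residue_preserving_perms k (length xs))) *
    (\<Sum>f\<in>assignments k (set es) (set xs). \<Prod>e\<in>set es. s e (f e))"
    (is "permanent ?A = of_nat ?K * _")
proof -
  define n where "n = length xs"
  define m where "m = k * n"
  define l where "l i = xs ! (i mod n)" for i
  define P where "P = {p. p permutes {0..<m}}"
  define F where "F = assignments k (set es) (set xs)"
  \<comment> \<open>\<open>\<Phi> p\<close> gives the edge in position \<open>i\<close> the vertex
    that labels row \<open>p i\<close>; here \<open>p\<close> runs from columns to rows.\<close>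
  define \<Phi> where "\<Phi> p = restrict (\<lambda>e. l (p (the_inv_into {0..<m} ((!) es) e))) (set es)" for p
  have m: "length es = m" using len by (simp add: m_def n_def)
  \<comment> \<open>Guards every later use of \<open>mod n\<close>: an index below
    \<open>k * n\<close> exists only if \<open>n\<close> is positive.\<close>
  have npos: "n > 0" if "i < m" for i using that by (auto simp: m_def intro: gr0I)
  have bij: "bij_betw ((!) es) {0..<m} (set es)"
    using bij_betw_nth[OF \<open>distinct es\<close>] m by (simp add: atLeast0LessThan)
  have finP: "finite P" unfolding P_def by (rule finite_permutations) simp
  have idx: "the_inv_into {0..<m} ((!) es) (es ! i) = i" if "i < m" for i
    using bij that by (auto simp: bij_betw_def intro: the_inv_into_f_f)
  have \<Phi>_nth: "\<Phi> p (es ! i) = l (p i)" if "i < m" for p i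
    using that m by (simp add: \<Phi>_def idx)
  have l_mem: "l i \<in> set xs" if "i < m" for i
    using npos[OF that] by (simp add: l_def n_def)
  have l_eq_iff: "l i = l j \<longleftrightarrow> i mod n = j mod n" if "i < m" "j < m" for i j
    using npos[OF that(1)] \<open>distinct xs\<close> by (simp add: l_def nth_eq_iff_index_eq n_def)
  have fib_l: "card {i \<in> {0..<m}. l i = x} = k" if x: "x \<in> set xs" for x
  proof -
    obtain a where a: "a < n" "x = xs ! a" using x by (metis in_set_conv_nth n_def)
    then have "l i = x \<longleftrightarrow> i mod n = a" if "i < m" for i
      using npos[OF that] \<open>distinct xs\<close> by (simp add: l_def nth_eq_iff_index_eq n_def)
    then have "{i \<in> {0..<m}. l i = x} = {i \<in> {0..<k * n}. i mod n = a}"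
      by (auto simp: m_def)
    then show ?thesis using card_residue_class[OF a(1)] by simp
  qed
  note fib_es = card_filter_bij_betw[OF bij]
  have \<Phi>_F: "\<Phi> ` P \<subseteq> F"
  proof
    fix f assume "f \<in> \<Phi> ` P"
    then obtain p where p: "p permutes {0..<m}" and f: "f = \<Phi> p" by (auto simp: P_def)
    have plt: "p i < m" if "i < m" for i using permutes_in_image[OF p, of i] that by simp
    have "f \<in> set es \<rightarrow>\<^sub>E set xs"
    proof (rule PiE_I)
      fix e assume "e \<in> set es"
      then obtain i where "i < m" "e = es ! i" using m by (auto simp: in_set_conv_nth)
      then show "f e \<in> set xs" using plt l_mem by (simp add: f \<Phi>_nth)
    qed (simp add: f \<Phi>_def)
    moreover have "card {e \<in> set es. f e = x} = k" if "x \<in> set xs" for x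
    proof -
      have "{i \<in> {0..<m}. f (es ! i) = x} = {i \<in> {0..<m}. l (p i) = x}"
        by (auto simp: f \<Phi>_nth)
      moreover have "card {i \<in> {0..<m}. l (p i) = x} = k"
        using card_filter_bij_betw[OF permutes_imp_bij[OF p], of "\<lambda>i. l i = x"] fib_l[OF that] by simp
      ultimately show ?thesis by (simp add: fib_es)
    qed
    ultimately show "f \<in> F" by (simp add: F_def assignments_def)
  qed
  have card_fibre: "card {p \<in> P. \<Phi> p = f} = ?K" if "f \<in> F" for f
  proof -
    have fE: "f \<in> set es \<rightarrow>\<^sub>E set xs" and fk: "\<And>x. x \<in> set xs \<Longrightarrow> card {e \<in> set es. f e = x} = k"
      using that by (auto simp: F_def assignments_def)
    \<comment> \<open>Both labellings of the positions take each vertex exactly \<open>k\<close>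
      times. Equal multisets of values yield a permutation \<open>q\<close> carrying one labelling
      to the other, so the fibre over \<open>f\<close> is nonempty.\<close>
    have "image_mset (\<lambda>i. f (es ! i)) (mset_set {0..<m}) = image_mset l (mset_set {0..<m})"
    proof (rule multiset_eqI)
      fix x
      have *: "count (image_mset g (mset_set {0..<m})) x = card {i \<in> {0..<m}. g i = x}" for g :: "nat \<Rightarrow> 'v"
        unfolding card_eq_sum count_image_mset' by (rule sum.cong) auto
      show "count (image_mset (\<lambda>i. f (es ! i)) (mset_set {0..<m})) x =
        count (image_mset l (mset_set {0..<m})) x"
      proof (cases "x \<in> set xs")
        case True
        then show ?thesis unfolding * using fib_l fk fib_es[of "\<lambda>e. f e = x"] by simp
      next
        case False
        have "f (es ! i) \<in> set xs" if "i < m" for i using fE that m by auto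
        with False l_mem have "{i \<in> {0..<m}. f (es ! i) = x} = {}" "{i \<in> {0..<m}. l i = x} = {}"
          by auto
        then show ?thesis unfolding * by (simp only:)
      qed
    qed
    with finite_atLeastLessThan obtain q where q: "q permutes {0..<m}"
      and "\<forall>i\<in>{0..<m}. f (es ! i) = l (q i)"
      by (rule image_mset_eq_implies_permutes)
    then have fq: "\<And>i. i < m \<Longrightarrow> f (es ! i) = l (q i)" by simp
    have qlt: "q i < m \<longleftrightarrow> i < m" for i using permutes_in_image[OF q, of i] by simp
    have eq_iff: "\<Phi> p = f \<longleftrightarrow> (\<forall>i<m. l (p i) = l (q i))" for p
    proof
      assume "\<forall>i<m. l (p i) = l (q i)"
      then have "\<Phi> p e = f e" if "e \<in> set es" for e
        using that m by (auto simp: in_set_conv_nth \<Phi>_nth fq)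
      moreover have "\<Phi> p e = f e" if "e \<notin> set es" for e
        using that PiE_arb[OF fE] by (simp add: \<Phi>_def)
      ultimately show "\<Phi> p = f" by blast
    qed (use \<Phi>_nth fq in metis)
    \<comment> \<open>The fibre over \<open>f\<close> is the coset of \<open>q\<close>: two
      permutations give the same labels exactly when they differ by a permutation that preserves
      residues, applied after \<open>q\<close>.\<close>
    have "{p \<in> P. \<Phi> p = f} = (\<lambda>r. r \<circ> q) ` residue_preserving_perms k n"
    proof (rule subset_antisym; rule subsetI)
      fix p assume "p \<in> {p \<in> P. \<Phi> p = f}"
      then have p: "p permutes {0..<m}" and pq: "\<And>i. i < m \<Longrightarrow> l (p i) = l (q i)"
        by (auto simp: P_def eq_iff)
      \<comment> \<open>\<open>inv_into UNIV\<close> because \<open>inv\<close> parses as the group inverse of \<open>HOL-Algebra\<close> here\<close>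
      have r: "p \<circ> inv_into UNIV q permutes {0..<m}"
        by (rule permutes_compose[OF permutes_inv[OF q] p])
      have "(p \<circ> inv_into UNIV q) i mod n = i mod n" if "i < m" for i
      proof -
        have iq: "inv_into UNIV q i < m" using qlt that permutes_inverses(1)[OF q, of i] by metis
        have "p (inv_into UNIV q i) < m" using permutes_in_image[OF p, of "inv_into UNIV q i"] iq by simp
        moreover have "l (p (inv_into UNIV q i)) = l i" using pq[OF iq] permutes_inverses(1)[OF q] by simp
        ultimately show ?thesis using l_eq_iff that by simp
      qed
      with r have "p \<circ> inv_into UNIV q \<in> residue_preserving_perms k n"
        by (simp add: residue_preserving_perms_def m_def)
      moreover have "p = (p \<circ> inv_into UNIV q) \<circ> q"
        using permutes_inverses(2)[OF q] by (simp add: fun_eq_iff)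
      ultimately show "p \<in> (\<lambda>r. r \<circ> q) ` residue_preserving_perms k n" by blast
    next
      fix p assume "p \<in> (\<lambda>r. r \<circ> q) ` residue_preserving_perms k n"
      then obtain r where r: "r permutes {0..<m}" "\<And>i. i < m \<Longrightarrow> r i mod n = i mod n"
        and p: "p = r \<circ> q"
        by (auto simp: residue_preserving_perms_def m_def)
      have "p permutes {0..<m}" unfolding p by (rule permutes_compose[OF q r(1)])
      moreover have "l (p i) = l (q i)" if "i < m" for i
        using r(2)[of "q i"] that qlt by (simp add: p l_def)
      ultimately show "p \<in> {p \<in> P. \<Phi> p = f}" by (simp add: P_def eq_iff)
    qed
    moreover have "inj_on (\<lambda>r. r \<circ> q) (residue_preserving_perms k n)"
      by (rule inj_onI) (metis permutes_inv_o(1)[OF q] comp_assoc comp_id)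
    ultimately show ?thesis by (simp add: card_image n_def)
  qed
  have "permanent ?A = (\<Sum>p\<in>P. \<Prod>i = 0..<m. s (es ! p i) (l i))"
  proof -
    have d: "dim_row ?A = m" "dim_col ?A = m" by (simp_all add: stack_copies_def m m_def n_def)
    show ?thesis
      unfolding permanent_def d P_def
    proof (simp only: refl if_True, intro sum.cong refl prod.cong)
      fix p i assume p: "p \<in> {p. p permutes {0..<m}}" and i: "i \<in> {0..<m}"
      then have "p i < m" using permutes_in_image[of p "{0..<m}" i] by simp
      then show "?A $$ (i, p i) = s (es ! p i) (l i)"
        using i m npos[of i] by (simp add: stack_copies_def l_def n_def m_def)
    qed
  qed
  \<comment> \<open>The permanent sends rows to columns while \<open>\<Phi>\<close> needs columns to
    rows, hence the passage to inverse permutations.\<close>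
  also have "\<dots> = (\<Sum>p\<in>P. \<Prod>i = 0..<m. s (es ! inv_into UNIV p i) (l i))"
    unfolding P_def by (rule sum_permutations_inverse)
  also have "\<dots> = (\<Sum>p\<in>P. \<Prod>e\<in>set es. s e (\<Phi> p e))"
  proof (rule sum.cong[OF refl])
    fix p assume "p \<in> P"
    then have p: "p permutes {0..<m}" by (simp add: P_def)
    have "(\<Prod>i = 0..<m. s (es ! inv_into UNIV p i) (l i)) = (\<Prod>i = 0..<m. s (es ! i) (l (p i)))"
      by (subst prod.permute[OF p]) (simp add: o_def permutes_inverses(2)[OF p])
    also have "\<dots> = (\<Prod>i = 0..<m. s (es ! i) (\<Phi> p (es ! i)))"
      by (intro prod.cong) (auto simp: \<Phi>_nth)
    also have "\<dots> = (\<Prod>e\<in>set es. s e (\<Phi> p e))"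
      by (rule prod.reindex_bij_betw[OF bij])
    finally show "(\<Prod>i = 0..<m. s (es ! inv_into UNIV p i) (l i)) = (\<Prod>e\<in>set es. s e (\<Phi> p e))" .
  qed
  also have "\<dots> = (\<Sum>f\<in>F. \<Sum>p\<in>{p \<in> P. \<Phi> p = f}. \<Prod>e\<in>set es. s e (\<Phi> p e))"
    by (rule sum.group[symmetric]) (use finP \<Phi>_F in \<open>auto simp: F_def finite_assignments\<close>)
  also have "\<dots> = (\<Sum>f\<in>F. of_nat ?K * (\<Prod>e\<in>set es. s e (f e)))"
    by (rule sum.cong) (simp_all add: card_fibre)
  finally show ?thesis by (simp add: F_def sum_distrib_left)
qed

section \<open>Incidence signs and closed walks\<close>

definition incidence :: "('e \<Rightarrow> 'v \<times> 'v) \<Rightarrow> 'e \<Rightarrow> 'v \<Rightarrow> int" where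
  "incidence d e x = (if x = fst (d e) then 1 else if x = snd (d e) then - 1 else 0)"

lemma incidence_square: "x \<in> {fst (d e), snd (d e)} \<Longrightarrow> incidence d e x * incidence d e x = 1"
  by (auto simp: incidence_def)

text \<open>The two ends of an edge carry opposite signs. Moving to the other end therefore flips
  the sign, and reversing the orientation flips it back.\<close>

lemma incidence_reverse:
  assumes "{fst (d e), snd (d e)} = {x, y}" "{fst (d' e), snd (d' e)} = {x, y}" "x \<noteq> y"
  shows "incidence d' e y = (if d e = d' e then - 1 else 1) * incidence d e x"
  using assms by (cases "d e"; cases "d' e") (auto simp: incidence_def doubleton_eq_iff)

lemma prod_sign_eq_power_card:
  fixes A :: "'a set"
  assumes "finite A"
  shows "(\<Prod>x\<in>A. if P x then - 1 else 1 :: int) = (- 1) ^ card {x \<in> A. P x}"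
  using assms by (simp add: prod.inter_filter[symmetric])

text \<open>The differences of the indicators of \<open>x\<close> at consecutive positions
  telescope, and the first and last positions agree.\<close>

lemma card_pred_eq_card_succ_closed_walk:
  assumes "xs ! 0 = xs ! n"
  shows "card {i \<in> {..<n}. xs ! i = x} = card {i \<in> {..<n}. xs ! Suc i = x}"
proof -
  have "(\<Sum>i<n. of_bool (xs ! Suc i = x) - of_bool (xs ! i = x) :: int) = 0"
    by (subst sum_lessThan_telescope) (simp add: assms)
  then have "int (card {i \<in> {..<n}. xs ! i = x}) = int (card {i \<in> {..<n}. xs ! Suc i = x})"
    by (simp add: sum_subtractf of_bool_def sum.inter_filter[symmetric])
  then show ?thesis by simp
qed

section \<open>Assignments on the two vertex-deleted graphs\<close>

text \<open>Meaningful when \<open>e\<close> is not a loop and \<open>x\<close> is one of its ends: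
  only then is the difference the singleton that \<open>the_elem\<close> expects.\<close>

definition other_end :: "('v, 'e) multigraph \<Rightarrow> 'e \<Rightarrow> 'v \<Rightarrow> 'v" where
  "other_end G e x = the_elem (ends G e - {x})"

text \<open>These are the assignments whose product of incidence signs is nonzero.\<close>

definition incident_assignments ::
  "nat \<Rightarrow> ('v, 'e) multigraph \<Rightarrow> 'v \<Rightarrow> 'v \<Rightarrow> ('e \<Rightarrow> 'v) set" where
  "incident_assignments k G v w =
     {f \<in> assignments k (edges (delete_vertex G v)) (verts G - {v, w}).
        \<forall>e \<in> edges (delete_vertex G v). f e \<in> ends G e}"

text \<open>Edges at \<open>v\<close> are treated as if they had been assigned \<open>v\<close>, so
  that one rule, passing to the other end, covers them and the edges avoiding both vertices.\<close>

definition complement_assignment ::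
  "('v, 'e) multigraph \<Rightarrow> 'v \<Rightarrow> 'v \<Rightarrow> ('e \<Rightarrow> 'v) \<Rightarrow> 'e \<Rightarrow> 'v" where
  "complement_assignment G v w f =
     restrict (\<lambda>e. other_end G e (if v \<in> ends G e then v else f e)) (edges (delete_vertex G w))"

text \<open>
  The three factors come from the edges joining \<open>w\<close> to the inner vertices (present only before the
  exchange), those joining \<open>v\<close> to them (present only after it), and those avoiding both, whose
  sign flips unless \<open>d'\<close> has already reversed the edge.
\<close>

definition exchange_sign ::
  "('v, 'e) multigraph \<Rightarrow> 'v \<Rightarrow> 'v \<Rightarrow> ('e \<Rightarrow> 'v \<times> 'v) \<Rightarrow> ('e \<Rightarrow> 'v \<times> 'v) \<Rightarrow> int" where
  "exchange_sign G v w d d' =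
     (\<Prod>e | e \<in> edges G \<and> w \<in> ends G e \<and> v \<notin> ends G e. incidence d e (other_end G e w)) *
     (\<Prod>e | e \<in> edges G \<and> v \<in> ends G e \<and> w \<notin> ends G e. incidence d' e (other_end G e v)) *
     (\<Prod>e | e \<in> edges G \<and> v \<notin> ends G e \<and> w \<notin> ends G e. if d e = d' e then - 1 else 1)"

lemma edges_delete_vertex: "edges (delete_vertex G v) = {e \<in> edges G. v \<notin> ends G e}"
  by (simp add: delete_vertex_def)

section \<open>Ends and degrees in loopless multigraphs\<close>

locale loopless_multigraph =
  fixes G :: "('v, 'e) multigraph"
  assumes fin: "finite_multigraph G" and no_loops: "loopless G"
begin

lemma finite_verts [simp]: "finite (verts G)"
  and finite_edges [simp]: "finite (edges G)"
  using fin by (auto simp: finite_multigraph_def)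

lemma other_end_eq: "ends G e = {x, y} \<Longrightarrow> x \<noteq> y \<Longrightarrow> other_end G e x = y"
  by (simp add: other_end_def)

lemma ends_eq:
  assumes "e \<in> edges G" "x \<in> ends G e"
  shows "ends G e = {x, other_end G e x}" "other_end G e x \<noteq> x"
    "x \<in> verts G" "other_end G e x \<in> verts G"
proof -
  obtain a b where ab: "a \<in> verts G" "b \<in> verts G" "ends G e = {a, b}"
    using fin assms(1) unfolding finite_multigraph_def by blast
  have "a \<noteq> b" using no_loops assms(1) ab(3) by (auto simp: loopless_def)
  with ab obtain y where y: "ends G e = {x, y}" "x \<noteq> y" "x \<in> verts G" "y \<in> verts G"
    using assms(2) by (metis insert_commute insertE singletonD)
  then show "ends G e = {x, other_end G e x}" "other_end G e x \<noteq> x"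
    "x \<in> verts G" "other_end G e x \<in> verts G"
    using other_end_eq[OF y(1,2)] by auto
qed

lemma other_end_mem: "e \<in> edges G \<Longrightarrow> x \<in> ends G e \<Longrightarrow> other_end G e x \<in> ends G e"
  using ends_eq(1)[of e x] by simp

lemma other_end_eqI:
  "e \<in> edges G \<Longrightarrow> x \<in> ends G e \<Longrightarrow> y \<in> ends G e \<Longrightarrow> x \<noteq> y \<Longrightarrow> other_end G e x = y"
  using ends_eq(1)[of e x] by simp

lemma other_end_other_end:
  "e \<in> edges G \<Longrightarrow> x \<in> ends G e \<Longrightarrow> other_end G e (other_end G e x) = x"
  by (rule other_end_eqI) (auto simp: other_end_mem ends_eq(2))

lemma degree_eq: "degree G x = card {e \<in> edges G. x \<in> ends G e}"
proof -
  have "{e \<in> edges G. ends G e = {x}} = {}" using no_loops by (auto simp: loopless_def)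
  then show ?thesis by (simp add: degree_def)
qed

lemma card_edges_delete_vertex: "card (edges G) = card (edges (delete_vertex G x)) + degree G x"
proof -
  have "edges G = edges (delete_vertex G x) \<union> {e \<in> edges G. x \<in> ends G e}"
    by (auto simp: edges_delete_vertex)
  then show ?thesis
    unfolding degree_eq
    by (metis (no_types, lifting) card_Un_disjoint finite_edges finite_Un disjoint_iff
        edges_delete_vertex mem_Collect_eq)
qed

section \<open>The exchange bijection\<close>

lemma incident_assignmentsD:
  assumes "f \<in> incident_assignments k G v w" "e \<in> edges G" "v \<notin> ends G e"
  shows "f e \<in> ends G e" "f e \<noteq> v" "f e \<noteq> w"
  using assms by (auto simp: incident_assignments_def assignments_def edges_delete_vertex)

text \<open>Each of the \<open>2 * k\<close> edges at an inner vertex \<open>x\<close> is assigned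
  to \<open>x\<close> either before or after the exchange, never both: an edge to \<open>w\<close>
  before, an edge to \<open>v\<close> after, and any other edge exactly once because its ends are
  swapped. As \<open>k\<close> of them are used before, \<open>k\<close> remain.\<close>

lemma complement_assignment_mem:
  assumes "regular (2 * k) G" "v \<in> verts G" "w \<in> verts G" "v \<noteq> w"
    and f: "f \<in> incident_assignments k G v w"
  shows "complement_assignment G v w f \<in> incident_assignments k G w v"
proof -
  let ?g = "complement_assignment G v w f"
  note fD = incident_assignmentsD[OF f]
  have g_v: "?g e = other_end G e v" if "e \<in> edges G" "v \<in> ends G e" "w \<notin> ends G e" for e
    using that by (simp add: complement_assignment_def edges_delete_vertex)
  have g_inner: "?g e = other_end G e (f e)" if "e \<in> edges G" "v \<notin> ends G e" "w \<notin> ends G e" for e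
    using that by (simp add: complement_assignment_def edges_delete_vertex)
  have g_ends: "?g e \<in> ends G e" "?g e \<in> verts G" "?g e \<noteq> v" "?g e \<noteq> w"
    if e: "e \<in> edges G" "w \<notin> ends G e" for e
  proof -
    have "?g e \<in> ends G e \<and> ?g e \<in> verts G \<and> ?g e \<noteq> v"
    proof (cases "v \<in> ends G e")
      case True
      then show ?thesis using e g_v ends_eq[of e v] other_end_mem by auto
    next
      case False
      then have "f e \<in> ends G e" using fD e by blast
      then show ?thesis using e False g_inner ends_eq[of e "f e"] other_end_mem by metis
    qed
    then show "?g e \<in> ends G e" "?g e \<in> verts G" "?g e \<noteq> v" "?g e \<noteq> w" using e by auto
  qed
  have "card {e \<in> edges (delete_vertex G w). ?g e = x} = k" if x: "x \<in> verts G - {v, w}" for x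
  proof -
    let ?A = "{e \<in> edges (delete_vertex G v). f e = x}"
    let ?B = "{e \<in> edges (delete_vertex G w). ?g e = x}"
    have A: "card ?A = k" using f x by (simp add: incident_assignments_def assignments_def)
    have inner: "e \<in> ?A \<longleftrightarrow> e \<notin> ?B"
      if "e \<in> edges G" "v \<notin> ends G e" "w \<notin> ends G e" "x \<in> ends G e" for e
      using that fD(1)[of e] ends_eq(2)[of e "f e"] other_end_eqI[of e "f e" x]
      by (auto simp: edges_delete_vertex g_inner)
    have "{e \<in> edges G. x \<in> ends G e} = ?A \<union> ?B"
    proof (rule subset_antisym; rule subsetI)
      fix e assume e: "e \<in> {e \<in> edges G. x \<in> ends G e}"
      show "e \<in> ?A \<union> ?B"
      proof (cases "v \<in> ends G e")
        case True
        then have "w \<notin> ends G e" using e x ends_eq(1)[of e v] \<open>v \<noteq> w\<close> by auto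
        moreover have "other_end G e v = x" using e x True by (intro other_end_eqI) auto
        ultimately show ?thesis using e True g_v by (auto simp: edges_delete_vertex)
      next
        case v: False
        show ?thesis
        proof (cases "w \<in> ends G e")
          case True
          have "other_end G e w = x" using e x True by (intro other_end_eqI) auto
          moreover have "other_end G e w = f e" using e v True fD[of e] by (intro other_end_eqI) auto
          ultimately show ?thesis using e v by (auto simp: edges_delete_vertex)
        qed (use inner e v in blast)
      qed
    qed (use fD g_ends in \<open>auto simp: edges_delete_vertex\<close>)
    moreover have "?A \<inter> ?B = {}"
      using inner fD(1) by (auto simp: edges_delete_vertex)
    moreover have "finite ?A" "finite ?B" by (simp_all add: edges_delete_vertex)
    ultimately have "degree G x = card ?A + card ?B" by (simp add: degree_eq card_Un_disjoint)
    then show ?thesis using \<open>regular (2 * k) G\<close> x A by (simp add: regular_def)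
  qed
  moreover have "?g \<in> edges (delete_vertex G w) \<rightarrow>\<^sub>E verts G - {v, w}"
    using g_ends by (intro PiE_I) (auto simp: complement_assignment_def edges_delete_vertex)
  ultimately show ?thesis
    using g_ends(1)
    by (simp add: incident_assignments_def assignments_def insert_commute edges_delete_vertex)
qed

text \<open>An edge at \<open>w\<close> that avoids \<open>v\<close> is forced onto its other end,
  which is what the return exchange assigns; an edge avoiding both vertices is swapped twice. Hence
  the exchange is a bijection between the two sets of incident assignments.\<close>

lemma complement_complement_assignment:
  assumes f: "f \<in> incident_assignments k G v w"
  shows "complement_assignment G w v (complement_assignment G v w f) = f"
proof
  fix e
  note fD = incident_assignmentsD[OF f, of e]
  show "complement_assignment G w v (complement_assignment G v w f) e = f e"
  proof (cases "e \<in> edges (delete_vertex G v)")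
    case True
    then have e: "e \<in> edges G" "v \<notin> ends G e" by (auto simp: edges_delete_vertex)
    show ?thesis
    proof (cases "w \<in> ends G e")
      case True
      then have "other_end G e w = f e" using e fD by (intro other_end_eqI) auto
      then show ?thesis using e True by (simp add: complement_assignment_def edges_delete_vertex)
    next
      case False
      have "other_end G e (other_end G e (f e)) = f e" using e fD by (intro other_end_other_end) auto
      then show ?thesis using e False by (simp add: complement_assignment_def edges_delete_vertex)
    qed
  next
    case False
    have "f \<in> edges (delete_vertex G v) \<rightarrow>\<^sub>E verts G - {v, w}"
      using f by (simp add: incident_assignments_def assignments_def)
    from PiE_arb[OF this False] show ?thesis using False by (simp add: complement_assignment_def)
  qed
qed

section \<open>The sign of the exchange\<close>

text \<open>Every factor is an incidence sign at an end of its edge or an explicit sign, so it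
  squares to 1.\<close>

lemma exchange_sign_square:
  assumes "orientation (delete_vertex G v) d" "orientation (delete_vertex G w) d'"
  shows "exchange_sign G v w d d' * exchange_sign G v w d d' = 1"
proof -
  have sq: "incidence \<delta> e (other_end G e y) * incidence \<delta> e (other_end G e y) = 1"
    if "orientation (delete_vertex G x) \<delta>" "e \<in> edges G" "y \<in> ends G e" "x \<notin> ends G e" for \<delta> e x y
    by (rule incidence_square)
      (use that other_end_mem in \<open>auto simp: orientation_def delete_vertex_def\<close>)
  have rearrange: "(a * b * c) * (a * b * c) = (a * a) * (b * b) * (c * c)" for a b c :: int
    by (simp add: algebra_simps)
  show ?thesis
    unfolding exchange_sign_def rearrange prod.distrib[symmetric]
    using sq[OF assms(1)] sq[OF assms(2)] by (simp add: if_distrib cong: if_cong)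
qed

lemma prod_incidence_complement_assignment:
  assumes d: "orientation (delete_vertex G v) d" and d': "orientation (delete_vertex G w) d'"
    and "v \<noteq> w" and f: "f \<in> incident_assignments k G v w"
  shows "(\<Prod>e\<in>edges (delete_vertex G w). incidence d' e (complement_assignment G v w f e)) =
    exchange_sign G v w d d' * (\<Prod>e\<in>edges (delete_vertex G v). incidence d e (f e))"
proof -
  let ?g = "complement_assignment G v w f"
  define W where "W = {e \<in> edges G. w \<in> ends G e \<and> v \<notin> ends G e}"
  define V where "V = {e \<in> edges G. v \<in> ends G e \<and> w \<notin> ends G e}"
  define I where "I = {e \<in> edges G. v \<notin> ends G e \<and> w \<notin> ends G e}"
  note fD = incident_assignmentsD[OF f]
  have Ev: "edges (delete_vertex G v) = W \<union> I" and Ew: "edges (delete_vertex G w) = V \<union> I"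
    by (auto simp: edges_delete_vertex V_def W_def I_def)
  have disj: "W \<inter> I = {}" "V \<inter> I = {}" and fins: "finite V" "finite W" "finite I"
    by (auto simp: V_def W_def I_def)
  have f_W: "f e = other_end G e w" if "e \<in> W" for e
    using that fD[of e] by (auto simp: W_def other_end_eqI)
  \<comment> \<open>The edges at \<open>w\<close> contribute only before the exchange. Their forced
    signs occur once in that product and once in \<open>exchange_sign\<close>, so they
    cancel.\<close>
  have W_sq: "(\<Prod>e\<in>W. incidence d e (other_end G e w)) * (\<Prod>e\<in>W. incidence d e (other_end G e w)) = 1"
    unfolding prod.distrib[symmetric]
    by (intro prod.neutral ballI incidence_square)
      (use d other_end_mem in \<open>auto simp: orientation_def delete_vertex_def W_def\<close>)
  have I: "incidence d' e (?g e) = (if d e = d' e then - 1 else 1) * incidence d e (f e)"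
    if "e \<in> I" for e
  proof -
    have e: "e \<in> edges G" "v \<notin> ends G e" "w \<notin> ends G e" using that by (auto simp: I_def)
    then have "?g e = other_end G e (f e)"
      by (simp add: complement_assignment_def edges_delete_vertex)
    moreover have "ends G e = {f e, ?g e}" "f e \<noteq> ?g e"
      using ends_eq[of e "f e"] fD(1)[of e] e calculation by auto
    moreover have "{fst (d e), snd (d e)} = ends G e" "{fst (d' e), snd (d' e)} = ends G e"
      using d d' e by (auto simp: orientation_def delete_vertex_def)
    ultimately show ?thesis by (intro incidence_reverse) simp_all
  qed
  have "(\<Prod>e\<in>edges (delete_vertex G w). incidence d' e (?g e)) =
      (\<Prod>e\<in>V. incidence d' e (?g e)) * (\<Prod>e\<in>I. incidence d' e (?g e))"
    unfolding Ew by (rule prod.union_disjoint) (use disj fins in auto)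
  also have "(\<Prod>e\<in>V. incidence d' e (?g e)) = (\<Prod>e\<in>V. incidence d' e (other_end G e v))"
    by (rule prod.cong) (auto simp: V_def complement_assignment_def edges_delete_vertex)
  also have "(\<Prod>e\<in>I. incidence d' e (?g e)) =
      (\<Prod>e\<in>I. if d e = d' e then - 1 else 1) * (\<Prod>e\<in>I. incidence d e (f e))"
    unfolding prod.distrib[symmetric] using I by (rule prod.cong[OF refl])
  finally have lhs: "(\<Prod>e\<in>edges (delete_vertex G w). incidence d' e (?g e)) =
      (\<Prod>e\<in>V. incidence d' e (other_end G e v)) *
      ((\<Prod>e\<in>I. if d e = d' e then - 1 else 1) * (\<Prod>e\<in>I. incidence d e (f e)))" .
  have "(\<Prod>e\<in>edges (delete_vertex G v). incidence d e (f e)) =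
      (\<Prod>e\<in>W. incidence d e (other_end G e w)) * (\<Prod>e\<in>I. incidence d e (f e))"
    unfolding Ev using disj fins f_W by (simp add: prod.union_disjoint)
  then have "exchange_sign G v w d d' * (\<Prod>e\<in>edges (delete_vertex G v). incidence d e (f e)) =
      ((\<Prod>e\<in>W. incidence d e (other_end G e w)) * (\<Prod>e\<in>W. incidence d e (other_end G e w))) *
      ((\<Prod>e\<in>V. incidence d' e (other_end G e v)) *
      ((\<Prod>e\<in>I. if d e = d' e then - 1 else 1) * (\<Prod>e\<in>I. incidence d e (f e))))"
    unfolding exchange_sign_def W_def[symmetric] V_def[symmetric] I_def[symmetric]
    by (simp only: mult_ac)
  then show ?thesis unfolding lhs W_sq by simp
qed

section \<open>Permanents of kDSI matrices\<close>

text \<open>An assignment that sends some edge to a vertex not on it contributes a zero entry, so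
  only incident assignments survive. The second branch is the non-square case, where
  \<open>permanent\<close> has default value 0.\<close>

lemma permanent_kDSI_matrix:
  assumes M: "kDSI_matrix_wrt k (delete_vertex G v) d w M"
  shows "permanent M =
    (if card (edges (delete_vertex G v)) = k * card (verts G - {v, w})
     then int (card (residue_preserving_perms k (card (verts G - {v, w})))) *
       (\<Sum>f\<in>incident_assignments k G v w. \<Prod>e\<in>edges (delete_vertex G v). incidence d e (f e))
     else 0)"
proof -
  let ?E = "edges (delete_vertex G v)" and ?X = "verts G - {v, w}"
  obtain xs es where xs: "distinct xs" "set xs = verts G - {v}"
    and es: "distinct es" "set es = ?E"
    and M_eq: "M = stack_copies k (signed_incidence_mat d (remove1 w xs) es)"
    using M by (auto simp: kDSI_matrix_wrt_def delete_vertex_def)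
  define ys where "ys = remove1 w xs"
  have ys: "distinct ys" "set ys = ?X" using xs by (auto simp: ys_def)
  have len: "length ys = card ?X" "length es = card ?E"
    using ys es by (metis distinct_card)+
  have M_mat: "M = stack_copies k (mat (length ys) (length es) (\<lambda>(i, j). incidence d (es ! j) (ys ! i)))"
    by (simp add: M_eq ys_def signed_incidence_mat_def incidence_def)
  show ?thesis
  proof (cases "card ?E = k * card ?X")
    case True
    have "(\<Sum>f\<in>assignments k ?E ?X. \<Prod>e\<in>?E. incidence d e (f e)) =
      (\<Sum>f\<in>incident_assignments k G v w. \<Prod>e\<in>?E. incidence d e (f e))"
    proof (rule sum.mono_neutral_right)
      show "finite (assignments k ?E ?X)" by (simp add: finite_assignments edges_delete_vertex)
      show "\<forall>f\<in>assignments k ?E ?X - incident_assignments k G v w. (\<Prod>e\<in>?E. incidence d e (f e)) = 0"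
      proof
        fix f assume "f \<in> assignments k ?E ?X - incident_assignments k G v w"
        then obtain e where e: "e \<in> ?E" "f e \<notin> ends G e" by (auto simp: incident_assignments_def)
        moreover have "ends G e = {fst (d e), snd (d e)}"
          using M e(1) by (simp add: kDSI_matrix_wrt_def orientation_def delete_vertex_def)
        ultimately have "incidence d e (f e) = 0" by (simp add: incidence_def)
        with e(1) show "(\<Prod>e\<in>?E. incidence d e (f e)) = 0"
          by (intro prod_zero) (auto simp: edges_delete_vertex)
      qed
    qed (auto simp: incident_assignments_def)
    then show ?thesis
      using permanent_eq_sum_assignments[of ys es k "incidence d"] True ys es len M_mat by simp
  next
    case False
    then show ?thesis using len by (simp add: M_mat permanent_def stack_copies_def)
  qed
qed

text \<open>The exchange bijection matches the terms of the two sums, and the sign relating matched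
  terms is the same for all of them.\<close>

lemma permanent_exchange:
  assumes reg: "regular (2 * k) G" and vw: "v \<in> verts G" "w \<in> verts G" "v \<noteq> w"
    and M: "kDSI_matrix_wrt k (delete_vertex G v) d w M"
    and N: "kDSI_matrix_wrt k (delete_vertex G w) d' v N"
  shows "permanent N = exchange_sign G v w d d' * permanent M"
proof -
  have or: "orientation (delete_vertex G v) d" "orientation (delete_vertex G w) d'"
    using M N by (auto simp: kDSI_matrix_wrt_def)
  \<comment> \<open>Deleting either vertex removes \<open>2 * k\<close> edges, so \<open>M\<close>
    and \<open>N\<close> are both square or both non-square.\<close>
  have cards: "card (edges (delete_vertex G v)) = card (edges (delete_vertex G w))"
    using card_edges_delete_vertex[of v] card_edges_delete_vertex[of w] reg vw
    by (simp add: regular_def)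
  have "(\<Sum>g\<in>incident_assignments k G w v. \<Prod>e\<in>edges (delete_vertex G w). incidence d' e (g e)) =
    (\<Sum>f\<in>incident_assignments k G v w.
      \<Prod>e\<in>edges (delete_vertex G w). incidence d' e (complement_assignment G v w f e))"
    by (rule sum.reindex_bij_witness[of _ "complement_assignment G v w" "complement_assignment G w v"])
      (use reg vw complement_assignment_mem complement_complement_assignment in auto)
  also have "\<dots> = exchange_sign G v w d d' *
    (\<Sum>f\<in>incident_assignments k G v w. \<Prod>e\<in>edges (delete_vertex G v). incidence d e (f e))"
    using prod_incidence_complement_assignment[OF or vw(3)] by (simp add: sum_distrib_left)
  finally show ?thesis
    unfolding permanent_kDSI_matrix[OF M] permanent_kDSI_matrix[OF N]
    using cards by (simp add: insert_commute mult_ac)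
qed

section \<open>Eulerian orientations and parity\<close>

lemma circuit_orientation_imp_orientation:
  assumes "eulerian_circuit G xs es" "circuit_orientation xs es d"
  shows "orientation G d"
  unfolding orientation_def
proof
  fix e assume "e \<in> edges G"
  then obtain i where "i < length es" "e = es ! i"
    using assms(1) by (metis eulerian_circuit_def in_set_conv_nth)
  then show "ends G e = {fst (d e), snd (d e)}"
    using assms by (simp add: eulerian_circuit_def circuit_orientation_def)
qed

text \<open>The closed walk leaves \<open>x\<close> as often as it enters it, and without loops the
  edges at \<open>x\<close> split into outgoing and incoming ones.\<close>

lemma out_degree_circuit_orientation:
  assumes circ: "eulerian_circuit G xs es" and d: "circuit_orientation xs es d"
    and deg: "degree G x = 2 * k"
  shows "card {e \<in> edges G. fst (d e) = x} = k"
proof -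
  have es: "distinct es" "set es = edges G" and len: "length xs = Suc (length es)"
    using circ by (auto simp: eulerian_circuit_def)
  have bij: "bij_betw ((!) es) {..<length es} (edges G)"
    using bij_betw_nth[OF es(1) refl es(2)[symmetric]] .
  note card_eq = card_filter_bij_betw[OF bij]
  have "xs ! 0 = xs ! length es"
    using circ len by (metis eulerian_circuit_def diff_Suc_1 hd_conv_nth last_conv_nth list.size(3)
        nat.distinct(1))
  then have "card {i \<in> {..<length es}. xs ! i = x} = card {i \<in> {..<length es}. xs ! Suc i = x}"
    by (rule card_pred_eq_card_succ_closed_walk)
  moreover have "{i \<in> {..<length es}. fst (d (es ! i)) = x} = {i \<in> {..<length es}. xs ! i = x}"
    "{i \<in> {..<length es}. snd (d (es ! i)) = x} = {i \<in> {..<length es}. xs ! Suc i = x}"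
    using d by (auto simp: circuit_orientation_def)
  ultimately have in_out: "card {e \<in> edges G. fst (d e) = x} = card {e \<in> edges G. snd (d e) = x}"
    by (simp add: card_eq)
  have or: "ends G e = {fst (d e), snd (d e)}" if "e \<in> edges G" for e
    using circuit_orientation_imp_orientation[OF circ d] that by (simp add: orientation_def)
  have "{e \<in> edges G. x \<in> ends G e} = {e \<in> edges G. fst (d e) = x} \<union> {e \<in> edges G. snd (d e) = x}"
    by (auto simp: or)
  moreover have "{e \<in> edges G. fst (d e) = x} \<inter> {e \<in> edges G. snd (d e) = x} = {}"
    using no_loops or by (auto simp: loopless_def)
  ultimately have "degree G x = card {e \<in> edges G. fst (d e) = x} + card {e \<in> edges G. snd (d e) = x}"
    by (simp add: degree_eq card_Un_disjoint)
  with in_out deg show ?thesis by simp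
qed

text \<open>The minus signs come from the edges leaving \<open>w\<close> not towards
  \<open>v\<close> (\<open>W\<close>), those leaving \<open>v\<close> not towards \<open>w\<close>
  (\<open>V\<close>), and all edges avoiding both (\<open>I\<close>), since a common orientation
  reverses none. Their number is \<open>card (edges G) - 2 * k\<close>, hence even.\<close>

lemma exchange_sign_eulerian:
  assumes d: "orientation G d" and "v \<noteq> w" and "even (card (edges G))"
    and deg: "degree G v = 2 * k" "degree G w = 2 * k"
    and out: "card {e \<in> edges G. fst (d e) = v} = k" "card {e \<in> edges G. fst (d e) = w} = k"
  shows "exchange_sign G v w d d = 1"
proof -
  define W where "W = {e \<in> edges G. fst (d e) = w \<and> snd (d e) \<noteq> v}"
  define V where "V = {e \<in> edges G. fst (d e) = v \<and> snd (d e) \<noteq> w}"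
  define I where "I = {e \<in> edges G. v \<notin> ends G e \<and> w \<notin> ends G e}"
  define P where "P = {e \<in> edges G. fst (d e) = w \<and> snd (d e) = v}"
  define Q where "Q = {e \<in> edges G. fst (d e) = v \<and> snd (d e) = w}"
  have or: "ends G e = {fst (d e), snd (d e)}" "fst (d e) \<noteq> snd (d e)" if "e \<in> edges G" for e
    using d no_loops that by (auto simp: orientation_def loopless_def)
  have sign: "(\<Prod>e | e \<in> edges G \<and> x \<in> ends G e \<and> y \<notin> ends G e. incidence d e (other_end G e x)) =
    (- 1) ^ card {e \<in> edges G. fst (d e) = x \<and> snd (d e) \<noteq> y}" if "x \<noteq> y" for x y
  proof -
    let ?A = "{e. e \<in> edges G \<and> x \<in> ends G e \<and> y \<notin> ends G e}"
    \<comment> \<open>The other end is the head, with sign -1, exactly when \<open>x\<close> is the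
      tail.\<close>
    have "incidence d e (other_end G e x) = (if fst (d e) = x then - 1 else 1)" if "e \<in> ?A" for e
    proof -
      have "other_end G e x = (if fst (d e) = x then snd (d e) else fst (d e))"
        using that or[of e] by (intro other_end_eqI) auto
      then show ?thesis using that or[of e] by (auto simp: incidence_def)
    qed
    then have "(\<Prod>e\<in>?A. incidence d e (other_end G e x)) =
        (\<Prod>e\<in>?A. if fst (d e) = x then - 1 else 1)"
      by (rule prod.cong[OF refl])
    also have "\<dots> = (- 1) ^ card {e \<in> ?A. fst (d e) = x}"
      by (rule prod_sign_eq_power_card) simp
    also have "{e \<in> ?A. fst (d e) = x} = {e \<in> edges G. fst (d e) = x \<and> snd (d e) \<noteq> y}"
      using that or by auto
    finally show ?thesis .
  qed
  have fins: "finite W" "finite V" "finite I" "finite P" "finite Q"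
    by (simp_all add: W_def V_def I_def P_def Q_def)
  have "{e \<in> edges G. fst (d e) = w} = W \<union> P" "W \<inter> P = {}"
    "{e \<in> edges G. fst (d e) = v} = V \<union> Q" "V \<inter> Q = {}"
    by (auto simp: W_def V_def P_def Q_def)
  then have outs: "card W + card P = k" "card V + card Q = k"
    using out fins by (simp_all add: card_Un_disjoint)
  let ?Ev = "{e \<in> edges G. v \<in> ends G e}" and ?Ew = "{e \<in> edges G. w \<in> ends G e}"
  \<comment> \<open>The edges joining \<open>v\<close> and \<open>w\<close>, split by direction into
    \<open>P\<close> and \<open>Q\<close>, are counted in both degrees; inclusion-exclusion corrects
    for them.\<close>
  have "?Ev \<inter> ?Ew = P \<union> Q" "P \<inter> Q = {}"
    using \<open>v \<noteq> w\<close> by (auto simp: P_def Q_def or)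
  moreover have "edges G = I \<union> (?Ev \<union> ?Ew)" "I \<inter> (?Ev \<union> ?Ew) = {}"
    by (auto simp: I_def)
  moreover have "card ?Ev + card ?Ew = card (?Ev \<union> ?Ew) + card (?Ev \<inter> ?Ew)"
    by (rule card_Un_Int) simp_all
  moreover have "card (I \<union> (?Ev \<union> ?Ew)) = card I + card (?Ev \<union> ?Ew)"
    by (rule card_Un_disjoint) (use calculation fins in auto)
  ultimately have "card (edges G) = card I + card (?Ev \<union> ?Ew)"
    "4 * k = card (?Ev \<union> ?Ew) + (card P + card Q)"
    using deg fins by (simp_all add: degree_eq card_Un_disjoint)
  with outs have "card W + card V + card I + 2 * k = card (edges G)" by linarith
  with \<open>even (card (edges G))\<close> have "even (card W + card V + card I)"
    by (metis dvd_triv_left even_add)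
  moreover have "exchange_sign G v w d d = (- 1) ^ (card W + card V + card I)"
    unfolding exchange_sign_def sign[OF \<open>v \<noteq> w\<close>] sign[OF \<open>v \<noteq> w\<close>[symmetric]]
    by (simp add: W_def V_def I_def power_add)
  ultimately show ?thesis by simp
qed

text \<open>If the permanent of \<open>M\<close> is nonzero, then \<open>M\<close> is square, and
  the number of edges is \<open>k\<close> times the number of inner vertices plus
  \<open>2 * k\<close>, which is even for even \<open>k\<close>. If it is zero, then so is the
  permanent of \<open>N\<close>, whatever the sign.\<close>

lemma permanent_exchange_eulerian:
  assumes reg: "regular (2 * k) G" and vw: "v \<in> verts G" "w \<in> verts G" "v \<noteq> w" and "even k"
    and circ: "eulerian_circuit G xs es" "circuit_orientation xs es d"
    and M: "kDSI_matrix_wrt k (delete_vertex G v) d w M"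
    and N: "kDSI_matrix_wrt k (delete_vertex G w) d v N"
  shows "permanent M = permanent N"
proof (cases "permanent M = 0")
  case True
  then show ?thesis using permanent_exchange[OF reg vw M N] by simp
next
  case False
  then have "card (edges (delete_vertex G v)) = k * card (verts G - {v, w})"
    by (metis permanent_kDSI_matrix[OF M])
  moreover have deg: "degree G v = 2 * k" "degree G w = 2 * k"
    using reg vw by (auto simp: regular_def)
  ultimately have "even (card (edges G))"
    using \<open>even k\<close> card_edges_delete_vertex[of v] by simp
  then have "exchange_sign G v w d d = 1"
    using deg vw circ
    by (intro exchange_sign_eulerian circuit_orientation_imp_orientation
        out_degree_circuit_orientation)
  then show ?thesis using permanent_exchange[OF reg vw M N] by simp
qed

end

theorem theorem4p2:
  fixes \<Gamma> :: "('v, 'e) multigraph" and k :: nat and v w :: 'v and M N :: "int mat"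
  assumes "k > 0"
    and "finite_multigraph \<Gamma>" and "connected_multigraph \<Gamma>" and "loopless \<Gamma>"
    and "regular (2 * k) \<Gamma>"
    and "v \<in> verts \<Gamma>" and "w \<in> verts \<Gamma>" and "v \<noteq> w"
    and "kDSI_matrix k (delete_vertex \<Gamma> v) w M"
    and "kDSI_matrix k (delete_vertex \<Gamma> w) v N"
  shows "(permanent M = permanent N \<or> permanent M = - permanent N) \<and>
    (even k \<longrightarrow>
      (\<forall>xs es d. eulerian_circuit \<Gamma> xs es \<and> circuit_orientation xs es d \<and>
         kDSI_matrix_wrt k (delete_vertex \<Gamma> v) d w M \<and>
         kDSI_matrix_wrt k (delete_vertex \<Gamma> w) d v N
         \<longrightarrow> permanent M = permanent N))"
proof -
  interpret loopless_multigraph \<Gamma> by unfold_locales (use assms in auto)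
  obtain d d' where M: "kDSI_matrix_wrt k (delete_vertex \<Gamma> v) d w M"
    and N: "kDSI_matrix_wrt k (delete_vertex \<Gamma> w) d' v N"
    using assms by (auto simp: kDSI_matrix_def)
  have "exchange_sign \<Gamma> v w d d' * exchange_sign \<Gamma> v w d d' = 1"
    using M N by (intro exchange_sign_square) (auto simp: kDSI_matrix_wrt_def)
  then have "exchange_sign \<Gamma> v w d d' = 1 \<or> exchange_sign \<Gamma> v w d d' = - 1"
    by (simp add: square_eq_1_iff)
  then have "permanent M = permanent N \<or> permanent M = - permanent N"
    using permanent_exchange[OF assms(5-8) M N] by auto
  \<comment> \<open>The orientations obtained above need not come from a circuit; the second claim
    works with the orientation of the given circuit instead.\<close>
  then show ?thesis using permanent_exchange_eulerian[OF assms(5-8)] by blast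
qed

end
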